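(* Let $(X,d)$ be a nonempty complete metric space and let $T:X\to X$ be a mapping. Suppose that there exists a pair of shifting distance functions $(\psi,\phi)$, with $\psi,\phi:[0,+\infty)\to\mathbb{R}$, such that $$\psi(d(Tx,Ty))\le \phi(d(x,y))\quad\text{for all } x,y\in X.$$ Then $T$ has a unique fixed point in $X$, that is, there exists exactly one $x^*\in X$ with $Tx^*=x^*$.
   Context: Let $\psi,\phi:[0,+\infty)\to\mathbb{R}$ be two functions (no continuity or monotonicity is assumed). The pair $(\psi,\phi)$ is called a pair of shifting distance functions if both of the following conditions hold: (i) for all $u,v\in[0,+\infty)$, if $\psi(u)\le\phi(v)$, then $u\le v$; (ii) for all sequences $\{u_n\}_{n\ge 0},\{v_n\}_{n\ge 0}\subset[0,+\infty)$ with $\lim_{n\to\infty}u_n=\lim_{n\to\infty}v_n=w$, if $\psi(u_n)\le\phi(v_n)$ for all $n\ge 0$, then $w=0$. *)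

theory Defs
  imports "HOL-Analysis.Analysis"
begin

(* The functions live on [0, \<infinity>). As HOL functions are total, they are given on all of real, but
   every argument is restricted to be nonnegative, so values at negative reals play no role. *)
definition shifting_distance_pair :: "(real \<Rightarrow> real) \<Rightarrow> (real \<Rightarrow> real) \<Rightarrow> bool" where
  "shifting_distance_pair \<psi> \<phi> \<longleftrightarrow>
     (\<forall>u\<ge>0. \<forall>v\<ge>0. \<psi> u \<le> \<phi> v \<longrightarrow> u \<le> v) \<and>
     (\<forall>(u :: nat \<Rightarrow> real) (v :: nat \<Rightarrow> real) w.
        (\<forall>n. u n \<ge> 0) \<longrightarrow> (\<forall>n. v n \<ge> 0) \<longrightarrow> u \<longlonglongrightarrow> w \<longrightarrow> v \<longlonglongrightarrow> w \<longrightarrow>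
        (\<forall>n. \<psi> (u n) \<le> \<phi> (v n)) \<longrightarrow> w = 0)"

end

theory Submission
  imports Defs
begin

text \<open>
  Condition (i) makes \<open>T\<close> nonexpansive, so the step sizes of a Picard orbit decrease to a limit,
  which is 0 by condition (ii). If the orbit were not Cauchy, there would be index pairs \<open>(p, q)\<close>
  such that \<open>d (x p) (x q)\<close> tends to some \<open>e > 0\<close>; because the step sizes vanish, the distances of
  the shifted pairs tend to the same \<open>e\<close>, contradicting (ii). The limit of the orbit is fixed since
  \<open>T\<close> is continuous, and (ii) for constant sequences gives uniqueness.
\<close>

lemma shifting_distance_pair_leD:
  assumes "shifting_distance_pair \<psi> \<phi>" "0 \<le> u" "0 \<le> v" "\<psi> u \<le> \<phi> v"
  shows "u \<le> v"
  using assms unfolding shifting_distance_pair_def by blast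

lemma shifting_distance_pair_limD:
  fixes u v :: "nat \<Rightarrow> real"
  assumes "shifting_distance_pair \<psi> \<phi>" "\<And>n. 0 \<le> u n" "\<And>n. 0 \<le> v n"
    "u \<longlonglongrightarrow> w" "v \<longlonglongrightarrow> w" "\<And>n. \<psi> (u n) \<le> \<phi> (v n)"
  shows "w = 0"
  using assms unfolding shifting_distance_pair_def by blast

text \<open>The index pairs come from stopping at the first exit from the ball of radius
  \<open>e\<close>; moving both indices by one costs at most two step sizes. The common limit is the
  form in which condition (ii) can be applied.\<close>

lemma (in Metric_space) not_MCauchy_shifted_indices:
  assumes a: "range a \<subseteq> M" and step: "(\<lambda>n. d (a n) (a (Suc n))) \<longlonglongrightarrow> 0"
    and "\<not> MCauchy a"
  obtains e :: real and p q :: "nat \<Rightarrow> nat" where "e > 0"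
    "(\<lambda>k. d (a (p k)) (a (q k))) \<longlonglongrightarrow> e"
    "(\<lambda>k. d (a (Suc (p k))) (a (Suc (q k)))) \<longlonglongrightarrow> e"
proof -
  have aM [simp]: "a n \<in> M" for n
    using a by auto
  obtain e where e: "e > 0" and far: "\<And>N. \<exists>m n. N \<le> m \<and> N \<le> n \<and> e \<le> d (a m) (a n)"
    using \<open>\<not> MCauchy a\<close> a unfolding MCauchy_def by (meson not_less)
  \<comment> \<open>One \<open>\<delta>\<close> bounds the overshoot of \<open>d (a p) (a q)\<close>
    above \<open>e\<close>; the other two pay for replacing \<open>p\<close> and \<open>q\<close> by
    their successors.\<close>
  have "\<exists>p q. \<bar>d (a p) (a q) - e\<bar> \<le> \<delta> \<and> \<bar>d (a (Suc p)) (a (Suc q)) - e\<bar> \<le> 3 * \<delta>"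
    if "\<delta> > 0" for \<delta>
  proof -
    obtain N where N: "\<And>n. n \<ge> N \<Longrightarrow> d (a n) (a (Suc n)) < \<delta>"
      using LIMSEQ_D[OF step \<open>\<delta> > 0\<close>] by auto
    \<comment> \<open>The two far indices come unordered; symmetry of \<open>d\<close> allows naming
      the smaller one \<open>p\<close>.\<close>
    obtain p q0 where p: "N \<le> p" "p \<le> q0" "e \<le> d (a p) (a q0)"
      using far[of N] by (metis commute nat_le_linear)
    \<comment> \<open>Taking the first index at distance at least \<open>e\<close> keeps that distance below \<open>e + \<delta>\<close>.\<close>
    define q where "q = (LEAST q. p \<le> q \<and> e \<le> d (a p) (a q))"
    have q: "p \<le> q" "e \<le> d (a p) (a q)"
      using LeastI[of "\<lambda>q. p \<le> q \<and> e \<le> d (a p) (a q)" q0] p unfolding q_def by auto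
    \<comment> \<open>Since \<open>d (a p) (a p) = 0 < e\<close>, \<open>q\<close> has a predecessor
      that is still at least \<open>p\<close>, to which minimality applies.\<close>
    have "q \<noteq> p"
      using q e by auto
    then obtain r where r: "q = Suc r" "p \<le> r"
      using q(1) by (cases q) auto
    have "d (a p) (a r) < e"
      using not_less_Least[of r "\<lambda>q. p \<le> q \<and> e \<le> d (a p) (a q)"] r unfolding q_def[symmetric]
      by auto
    moreover have "d (a r) (a q) < \<delta>" "d (a p) (a (Suc p)) < \<delta>" "d (a q) (a (Suc q)) < \<delta>"
      using N[of r] N[of p] N[of q] r p by auto
    moreover have "d (a p) (a q) \<le> d (a p) (a r) + d (a r) (a q)"
      "d (a p) (a q) \<le> d (a p) (a (Suc p)) + d (a (Suc p)) (a q)"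
      "d (a (Suc p)) (a q) \<le> d (a (Suc p)) (a (Suc q)) + d (a (Suc q)) (a q)"
      "d (a (Suc p)) (a (Suc q)) \<le> d (a (Suc p)) (a p) + d (a p) (a (Suc q))"
      "d (a p) (a (Suc q)) \<le> d (a p) (a q) + d (a q) (a (Suc q))"
      by (rule triangle; simp)+
    ultimately have "\<bar>d (a p) (a q) - e\<bar> \<le> \<delta> \<and> \<bar>d (a (Suc p)) (a (Suc q)) - e\<bar> \<le> 3 * \<delta>"
      using q(2) commute[of "a p" "a (Suc p)"] commute[of "a q" "a (Suc q)"] by linarith
    then show ?thesis by blast
  qed
  \<comment> \<open>Take \<open>\<delta> = 1 / (k + 1)\<close>.\<close>
  then have "\<forall>k. \<exists>p q. \<bar>d (a p) (a q) - e\<bar> \<le> inverse (real (Suc k)) \<and>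
      \<bar>d (a (Suc p)) (a (Suc q)) - e\<bar> \<le> 3 * inverse (real (Suc k))"
    by simp
  then obtain p q where
    pq: "\<And>k. \<bar>d (a (p k)) (a (q k)) - e\<bar> \<le> inverse (real (Suc k))" and
    pq': "\<And>k. \<bar>d (a (Suc (p k))) (a (Suc (q k))) - e\<bar> \<le> 3 * inverse (real (Suc k))"
    by metis
  have "(\<lambda>k. d (a (p k)) (a (q k)) - e) \<longlonglongrightarrow> 0"
    by (rule Lim_null_comparison[OF _ LIMSEQ_inverse_real_of_nat]) (use pq in simp)
  moreover have "(\<lambda>k. d (a (Suc (p k))) (a (Suc (q k))) - e) \<longlonglongrightarrow> 0"
    by (rule Lim_null_comparison[OF _ tendsto_mult_right_zero[OF LIMSEQ_inverse_real_of_nat, where c = 3]])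
      (use pq' in simp)
  ultimately show thesis
    using that[OF e, of p q] by (simp add: LIM_zero_iff)
qed

theorem theorem8:
  fixes X :: "'a set" and d :: "'a \<Rightarrow> 'a \<Rightarrow> real" and T :: "'a \<Rightarrow> 'a"
  assumes "Metric_space X d"
    and "Metric_space.mcomplete X d"
    and "X \<noteq> {}"
    and "T \<in> X \<rightarrow> X"
    and "\<exists>\<psi> \<phi>. shifting_distance_pair \<psi> \<phi> \<and>
           (\<forall>x\<in>X. \<forall>y\<in>X. \<psi> (d (T x) (T y)) \<le> \<phi> (d x y))"
  shows "\<exists>!x. x \<in> X \<and> T x = x"
proof -
  interpret Metric_space X d by fact
  obtain \<psi> \<phi> where pair: "shifting_distance_pair \<psi> \<phi>"
    and contr: "\<And>x y. x \<in> X \<Longrightarrow> y \<in> X \<Longrightarrow> \<psi> (d (T x) (T y)) \<le> \<phi> (d x y)"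
    using assms(5) by blast
  have TX: "T x \<in> X" if "x \<in> X" for x
    using assms(4) that by auto
  have nonexp: "d (T x) (T y) \<le> d x y" if "x \<in> X" "y \<in> X" for x y
    using shifting_distance_pair_leD[OF pair _ _ contr[OF that]] by simp
  obtain x0 where "x0 \<in> X"
    using assms(3) by blast
  define a where "a n = (T ^^ n) x0" for n
  have aX: "a n \<in> X" for n
    by (induction n) (auto simp: a_def \<open>x0 \<in> X\<close> TX)
  have aSuc: "a (Suc n) = T (a n)" for n
    by (simp add: a_def)
  have step: "(\<lambda>n. d (a n) (a (Suc n))) \<longlonglongrightarrow> 0"
  proof -
    have "decseq (\<lambda>n. d (a n) (a (Suc n)))"
      using nonexp aX by (simp add: decseq_Suc_iff aSuc TX)
    then obtain w where w: "(\<lambda>n. d (a n) (a (Suc n))) \<longlonglongrightarrow> w"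
      using decseq_convergent[of _ 0] nonneg by metis
    \<comment> \<open>In condition (ii), \<open>u\<close> is the sequence of step sizes shifted by
      one and \<open>v\<close> the sequence itself.\<close>
    have "w = 0"
      by (rule shifting_distance_pair_limD[OF pair _ _ LIMSEQ_Suc[OF w] w])
        (use contr aX in \<open>auto simp: aSuc TX\<close>)
    with w show ?thesis by simp
  qed
  have "MCauchy a"
  proof (rule ccontr)
    assume "\<not> MCauchy a"
    moreover have "range a \<subseteq> X"
      using aX by auto
    ultimately obtain e p q where "e > 0"
      and lims: "(\<lambda>k. d (a (p k)) (a (q k))) \<longlonglongrightarrow> e"
        "(\<lambda>k. d (a (Suc (p k))) (a (Suc (q k)))) \<longlonglongrightarrow> e"
      using not_MCauchy_shifted_indices step by blast
    \<comment> \<open>The shifted distances play \<open>u\<close>, as they are distances between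
      images under \<open>T\<close>; the original ones play \<open>v\<close>.\<close>
    have "e = 0"
      by (rule shifting_distance_pair_limD[OF pair _ _ lims(2,1)])
        (use contr aX in \<open>auto simp: aSuc\<close>)
    with \<open>e > 0\<close> show False by simp
  qed
  then obtain x where lim: "limitin mtopology a x sequentially"
    using assms(2) unfolding mcomplete_def by blast
  then have x: "x \<in> X" and dist0: "(\<lambda>n. d (a n) x) \<longlonglongrightarrow> 0"
    by (auto simp: limitin_metric_dist_null)
  \<comment> \<open>Nonexpansiveness gives the domination by \<open>d (a n) x\<close>.\<close>
  have "(\<lambda>n. d (a (Suc n)) (T x)) \<longlonglongrightarrow> 0"
    by (rule Lim_null_comparison[OF _ dist0]) (use nonexp[OF aX x] in \<open>simp add: aSuc\<close>)
  then have "limitin mtopology (\<lambda>n. a (Suc n)) (T x) sequentially"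
    unfolding limitin_metric_dist_null using TX[OF x] aX by simp
  moreover have "limitin mtopology (\<lambda>n. a (Suc n)) x sequentially"
    using limitin_sequentially_offset[OF lim, of 1] by simp
  ultimately have "T x = x"
    by (rule limitin_metric_unique) simp
  moreover have "y = x" if "y \<in> X" "T y = y" for y
  proof -
    \<comment> \<open>As both points are fixed, the hypothesis on \<open>T\<close> reads
      \<open>\<psi> (d y x) \<le> \<phi> (d y x)\<close>.\<close>
    have "d y x = 0"
      by (rule shifting_distance_pair_limD[OF pair _ _ tendsto_const tendsto_const])
        (use contr[OF that(1) x] that(2) \<open>T x = x\<close> in auto)
    with that(1) x show ?thesis by simp
  qed
  ultimately show ?thesis
    using x by blast
qed

end
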